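(* For every integer $h\ge6$, let $$T_h=B(\underbrace{7,\ldots,7}_{h-5},11,3,163,13\,;\,\underbrace{84,\ldots,84}_{h-5},80,52,0,0),$$ i.e. the level-uniform pendant extension $B(d_h,\ldots,d_2;t_h,\ldots,t_2)$ with $(d_i,t_i)=(7,84)$ for $6\le i\le h$, $(d_5,t_5)=(11,80)$, $(d_4,t_4)=(3,52)$, $(d_3,t_3)=(163,0)$, $(d_2,t_2)=(13,0)$. Then $T_h$ has exactly three main eigenvalues, its main characteristic polynomial is $$\varphi_M(T_h,x)=x^3-7x^2-84x=x(x^2-7x-84),$$ and $\operatorname{diam}(T_h)=2(h-1)$. Hence trees with exactly three main eigenvalues have unbounded diameter.
   Context: All graphs are finite, simple and undirected. An eigenvalue $\lambda$ of the adjacency matrix of a graph $G$ is a main eigenvalue if its eigenspace is not orthogonal to the all-ones vector $\mathbf j$. If $\lambda_1,\dots,\lambda_k$ are the distinct main eigenvalues of $G$, the main characteristic polynomial is $\varphi_M(G,x)=\prod_{i=1}^k(x-\lambda_i)$. $B(d_h,d_{h-1},\ldots,d_2)$ is the rooted tree with levels $C_h,C_{h-1},\ldots,C_1$, where $C_h$ consists of the root only; the root has $d_h$ children in $C_{h-1}$; for $2\le i\le h-1$, each vertex in $C_i$ has one parent in $C_{i+1}$ and $d_i-1$ children in $C_{i-1}$; and the vertices in $C_1$ have degree $1$. For nonnegative integers $t_h,\ldots,t_2$, the tree $B(d_h,\ldots,d_2;t_h,\ldots,t_2)$ is obtained from $B(d_h,\ldots,d_2)$ by attaching $t_i$ new pendant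 vertices to each vertex of $C_i$, for $i=2,\ldots,h$. *)

theory Defs
  imports "Graph_Theory.Graph_Theory" "Jordan_Normal_Form.Char_Poly"
begin

text \<open>
  A finite simple undirected graph is a digraph satisfying \<^locale>\<open>pair_graph\<close>: its arcs are
  ordered pairs of vertices, and each edge is present in both directions.
\<close>

subsection \<open>Trees and diameter\<close>

text \<open>
  In a symmetric digraph, going along an edge and back counts as a directed cycle (of length 2), so
  the library's \<^const>\<open>tree\<close> does not apply. Closed walks of length at least 3 whose vertices
  are distinct are exactly the cycles of the undirected graph.
\<close>
definition undirected_tree :: "'a pair_pre_digraph \<Rightarrow> bool" where
  "undirected_tree G \<longleftrightarrow>
     pair_graph G \<and> connected (with_proj G) \<and>
     \<not> (\<exists>p. pre_digraph.cycle (with_proj G) p \<and> 3 \<le> length p)"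

text \<open>The distance is the minimal cost of a walk when every arc has weight 1.\<close>
definition graph_dist :: "'a pair_pre_digraph \<Rightarrow> 'a \<Rightarrow> 'a \<Rightarrow> ereal" where
  "graph_dist G u v = wf_digraph.\<mu> (with_proj G) (\<lambda>_. 1) u v"

definition diam :: "'a pair_pre_digraph \<Rightarrow> ereal" where
  "diam G = (SUP (u, v) \<in> pverts G \<times> pverts G. graph_dist G u v)"

subsection \<open>Main eigenvalues\<close>

text \<open>
  A matrix needs an ordering of the vertices; an arbitrary one is fixed. Another ordering conjugates
  the matrix by a permutation matrix, which fixes the all-ones vector, so the main eigenvalues do
  not depend on the choice.
\<close>
definition vertex_list :: "'a pair_pre_digraph \<Rightarrow> 'a list" where
  "vertex_list G = (SOME vs. distinct vs \<and> set vs = pverts G)"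

definition adjacency_matrix :: "'a pair_pre_digraph \<Rightarrow> real mat" where
  "adjacency_matrix G =
     (let vs = vertex_list G; n = length vs
      in mat n n (\<lambda>(i, j). if (vs ! i, vs ! j) \<in> parcs G then 1 else 0))"

definition all_ones :: "nat \<Rightarrow> real vec" where
  "all_ones n = vec n (\<lambda>_. 1)"

definition main_eigenvalue :: "'a pair_pre_digraph \<Rightarrow> real \<Rightarrow> bool" where
  "main_eigenvalue G x \<longleftrightarrow>
     (let A = adjacency_matrix G
      in eigenvalue A x \<and> (\<exists>v. eigenvector A v x \<and> v \<bullet> all_ones (dim_row A) \<noteq> 0))"

definition main_eigenvalues :: "'a pair_pre_digraph \<Rightarrow> real set" where
  "main_eigenvalues G = {x. main_eigenvalue G x}"

definition main_char_poly :: "'a pair_pre_digraph \<Rightarrow> real poly" where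
  "main_char_poly G = (\<Prod>x\<in>main_eigenvalues G. [:- x, 1:])"

subsection \<open>Level-uniform trees and their pendant extensions\<close>

text \<open>
  The list \<open>ds = [d\<^sub>h, \<dots>, d\<^sub>2]\<close> has length \<open>h - 1\<close> and is indexed by the depth: the vertices of
  \<open>C\<^sub>i\<close> are at depth \<open>k = h - i\<close>, and \<open>d\<^sub>i = ds ! k\<close>. A vertex is the list of child numbers on
  the way down from the root \<open>[]\<close>, so its length is its depth. It is assumed that every \<open>d\<^sub>i\<close> is
  positive, as \<open>d\<^sub>i - 1\<close> is a truncated difference.
\<close>
definition num_children :: "nat list \<Rightarrow> nat \<Rightarrow> nat" where
  "num_children ds k = (if k = 0 then ds ! 0 else ds ! k - 1)"

definition B_verts :: "nat list \<Rightarrow> nat list set" where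
  "B_verts ds = {p. length p \<le> length ds \<and> (\<forall>k<length p. p ! k < num_children ds k)}"

definition B_tree :: "nat list \<Rightarrow> nat list pair_pre_digraph" where
  "B_tree ds =
     \<lparr> pverts = B_verts ds,
       parcs = {(p, q). p \<in> B_verts ds \<and> q \<in> B_verts ds \<and>
                        ((\<exists>c. q = p @ [c]) \<or> (\<exists>c. p = q @ [c]))} \<rparr>"

text \<open>Attach \<open>s v\<close> new pendant vertices \<open>Inr (v, 0), \<dots>, Inr (v, s v - 1)\<close> to each vertex \<open>v\<close>.\<close>
definition attach_pendants ::
    "'a pair_pre_digraph \<Rightarrow> ('a \<Rightarrow> nat) \<Rightarrow> ('a + 'a \<times> nat) pair_pre_digraph" where
  "attach_pendants G s =
     \<lparr> pverts = Inl ` pverts G \<union> {Inr (v, k) | v k. v \<in> pverts G \<and> k < s v},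
       parcs = {(Inl u, Inl v) | u v. (u, v) \<in> parcs G}
             \<union> {(Inl v, Inr (v, k)) | v k. v \<in> pverts G \<and> k < s v}
             \<union> {(Inr (v, k), Inl v) | v k. v \<in> pverts G \<and> k < s v} \<rparr>"

text \<open>
  \<open>ts = [t\<^sub>h, \<dots>, t\<^sub>2]\<close>, of the same length as \<open>ds\<close>. The vertices of \<open>C\<^sub>1\<close>, at depth \<open>length ts\<close>,
  get no pendant vertices.
\<close>
definition B_ext :: "nat list \<Rightarrow> nat list \<Rightarrow> (nat list + nat list \<times> nat) pair_pre_digraph" where
  "B_ext ds ts =
     attach_pendants (B_tree ds) (\<lambda>p. if length p < length ts then ts ! length p else 0)"

definition T_tree :: "nat \<Rightarrow> (nat list + nat list \<times> nat) pair_pre_digraph" where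
  "T_tree h = B_ext (replicate (h - 5) 7 @ [11, 3, 163, 13]) (replicate (h - 5) 84 @ [80, 52, 0, 0])"

end

theory Submission
  imports Defs
begin

section \<open>Outline\<close>

text \<open>
  Let \<open>A\<close> be the adjacency matrix and \<open>j\<close> the all-ones vector. As \<open>A\<close> is symmetric, \<open>j\<close> is the sum
  of its projections to the eigenspaces, and the projections that do not vanish belong to the main
  eigenvalues. Hence the main eigenvalues are the roots of the polynomial \<open>P\<close> of least degree with
  \<open>P(A) j = 0\<close> (lemma \<open>main_eigenvalues_eq_roots\<close>).

  In a pendant extension of a level-uniform tree, the entries of \<open>A\<^sup>i j\<close>, which count the walks of
  length \<open>i\<close> that start at a vertex, depend only on the level of the vertex and on whether it is one
  of the attached pendant vertices; so \<open>A\<close> acts on level functions by a three-term recurrence along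
  the levels (lemma \<open>nbr_sum_level_fun\<close>). For \<open>T\<^sub>h\<close>, the values of \<open>A j\<close> and \<open>A\<^sup>2 j\<close> on the levels
  \<open>C\<^sub>1, C\<^sub>2, C\<^sub>3, C\<^sub>4\<close> and on all higher levels are
  \<^item> \<open>1, 13, 163, 55, 91\<close> for \<open>A j\<close>,
  \<^item> \<open>13, 175, 2161, 469, 721\<close> for \<open>A\<^sup>2 j\<close>,

  while on a pendant vertex they are \<open>1\<close> and the degree of its neighbour. The parameters are chosen
  such that \<open>A\<^sup>3 j = 7 A\<^sup>2 j + 84 A j\<close>. From \<open>C\<^sub>5\<close> upwards the values are constant, because there every
  vertex has degree \<open>91\<close> and exactly \<open>7\<close> neighbours of degree \<open>91\<close>, except that a vertex of \<open>C\<^sub>5\<close> has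
  one such neighbour and \<open>10\<close> of degree \<open>55\<close>, with \<open>91 + 10 * 55 + 80 = 7 * 91 + 84\<close>. This is why
  the number of levels can be arbitrary. The vectors \<open>j, A j, A\<^sup>2 j\<close> are linearly independent, as
  their values on three vertices show, so \<open>x\<^sup>3 - 7 x\<^sup>2 - 84 x\<close> is the minimal polynomial, and its
  roots \<open>0\<close> and \<open>(7 \<plusminus> \<surd>385) / 2\<close> are distinct.

  For the diameter, every vertex is within distance \<open>h - 1\<close> of the root, and two leaves of \<open>C\<^sub>1\<close> below
  different children of the root are at distance \<open>2 (h - 1)\<close>: the depth, taken with a negative sign
  below one fixed child of the root, changes by at most \<open>1\<close> along an edge (lemma \<open>diam_B_ext\<close>).
\<close>

section \<open>Main eigenvalues as roots of a minimal polynomial\<close>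

text \<open>
  The adjacency matrix acting on functions on the vertices; unlike the matrix, it does not depend on
  an ordering of the vertices.
\<close>
definition nbr_sum :: "'a pair_pre_digraph \<Rightarrow> ('a \<Rightarrow> real) \<Rightarrow> 'a \<Rightarrow> real" where
  "nbr_sum G f v = (\<Sum>w | w \<in> pverts G \<and> (v, w) \<in> parcs G. f w)"

lemma nbr_sum_cong:
  "(\<And>w. w \<in> pverts G \<Longrightarrow> f w = g w) \<Longrightarrow> nbr_sum G f = nbr_sum G g"
  unfolding nbr_sum_def by (intro ext sum.cong) auto

lemma nbr_sum_add: "nbr_sum G (\<lambda>v. f v + g v) u = nbr_sum G f u + nbr_sum G g u"
  unfolding nbr_sum_def by (rule sum.distrib)

lemma nbr_sum_scale: "nbr_sum G (\<lambda>v. c * f v) u = c * nbr_sum G f u"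
  unfolding nbr_sum_def by (simp add: sum_distrib_left)

lemma nbr_sum_self_adjoint:
  assumes fin: "finite (pverts G)" and "sym (parcs G)"
  shows "(\<Sum>v\<in>pverts G. nbr_sum G f v * g v) = (\<Sum>v\<in>pverts G. f v * nbr_sum G g v)"
proof -
  have "(\<Sum>v\<in>pverts G. nbr_sum G f v * g v)
      = (\<Sum>v\<in>pverts G. \<Sum>w | w \<in> pverts G \<and> (v, w) \<in> parcs G. f w * g v)"
    unfolding nbr_sum_def by (simp add: sum_distrib_right)
  also have "\<dots> = (\<Sum>w\<in>pverts G. \<Sum>v | v \<in> pverts G \<and> (v, w) \<in> parcs G. f w * g v)"
    using fin by (rule sum.swap_restrict[OF _ fin])
  also have "\<dots> = (\<Sum>w\<in>pverts G. \<Sum>v | v \<in> pverts G \<and> (w, v) \<in> parcs G. f w * g v)"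
    using symD[OF assms(2)] by (intro sum.cong refl) blast
  finally show ?thesis
    unfolding nbr_sum_def by (simp add: sum_distrib_left)
qed

lemma nth_vertex_list_bij:
  assumes "finite (pverts G)"
  shows "bij_betw (\<lambda>i. vertex_list G ! i) {0..<length (vertex_list G)} (pverts G)"
proof -
  obtain vs where "distinct vs \<and> set vs = pverts G"
    using finite_distinct_list[OF assms] by blast
  then have "distinct (vertex_list G) \<and> set (vertex_list G) = pverts G"
    unfolding vertex_list_def by (rule someI)
  then show ?thesis
    by (metis bij_betw_nth atLeast0LessThan)
qed

text \<open>
  Vectors indexed by the positions in the chosen vertex list are functions on the vertices, and a
  function with nonzero sum cannot vanish identically, so it is an eigenvector.
\<close>
lemma main_eigenvalue_iff_nbr_sum:
  assumes fin: "finite (pverts G)"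
  shows "main_eigenvalue G x \<longleftrightarrow>
    (\<exists>f. (\<forall>v\<in>pverts G. nbr_sum G f v = x * f v) \<and> (\<Sum>v\<in>pverts G. f v) \<noteq> 0)"
proof -
  define vs where "vs = vertex_list G"
  define n where "n = length vs"
  define A where "A = adjacency_matrix G"
  define vec_of where "vec_of f = vec n (\<lambda>i. f (vs ! i))" for f :: "'a \<Rightarrow> real"
  have bij: "bij_betw (\<lambda>i. vs ! i) {0..<n} (pverts G)"
    using nth_vertex_list_bij[OF fin] by (simp add: vs_def n_def)
  have A: "A = mat n n (\<lambda>(i, j). if (vs ! i, vs ! j) \<in> parcs G then 1 else 0)"
    by (simp add: A_def adjacency_matrix_def vs_def n_def Let_def)
  have in_verts: "vs ! i \<in> pverts G" if "i < n" for i
    using bij that by (auto dest: bij_betwE)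
  have ex_index: "\<exists>i<n. v = vs ! i" if "v \<in> pverts G" for v
    using bij that by (force simp: bij_betw_def)
  have sum_verts: "(\<Sum>i = 0..<n. g (vs ! i)) = (\<Sum>v\<in>pverts G. g v)" for g :: "'a \<Rightarrow> real"
    by (rule sum.reindex_bij_betw[OF bij])
  have mult: "A *\<^sub>v vec_of f = vec_of (nbr_sum G f)" for f
  proof (rule eq_vecI)
    fix i assume "i < dim_vec (vec_of (nbr_sum G f))"
    then have i: "i < n" by (simp add: vec_of_def)
    then have "(A *\<^sub>v vec_of f) $ i = (\<Sum>j = 0..<n. (if (vs ! i, vs ! j) \<in> parcs G then f (vs ! j) else 0))"
      by (auto simp: A vec_of_def scalar_prod_def intro!: sum.cong)
    also have "\<dots> = (\<Sum>w\<in>pverts G. if (vs ! i, w) \<in> parcs G then f w else 0)"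
      by (rule sum_verts)
    also have "\<dots> = nbr_sum G f (vs ! i)"
      unfolding nbr_sum_def using fin by (simp add: sum.inter_filter)
    finally show "(A *\<^sub>v vec_of f) $ i = vec_of (nbr_sum G f) $ i"
      using i by (simp add: vec_of_def)
  qed (simp add: A vec_of_def)
  have ones: "vec_of f \<bullet> all_ones n = (\<Sum>v\<in>pverts G. f v)" for f
    by (simp add: vec_of_def all_ones_def scalar_prod_def sum_verts)
  have surj: "\<exists>f. v = vec_of f" if "v \<in> carrier_vec n" for v
  proof -
    define f where "f w = v $ (inv_into {0..<n} (\<lambda>i. vs ! i) w)" for w
    have "v = vec_of f"
      using that bij_betw_inv_into_left[OF bij] by (intro eq_vecI) (auto simp: vec_of_def f_def)
    then show ?thesis by blast
  qed
  have eq: "vec_of f = x \<cdot>\<^sub>v vec_of g \<longleftrightarrow> (\<forall>v\<in>pverts G. f v = x * g v)" for f g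
    using ex_index in_verts by (fastforce simp: vec_of_def vec_eq_iff)
  have "main_eigenvalue G x \<longleftrightarrow> (\<exists>v. eigenvector A v x \<and> v \<bullet> all_ones n \<noteq> 0)"
    unfolding main_eigenvalue_def A_def[symmetric] Let_def eigenvalue_def by (auto simp: A)
  also have "\<dots> \<longleftrightarrow> (\<exists>v\<in>carrier_vec n. A *\<^sub>v v = x \<cdot>\<^sub>v v \<and> v \<bullet> all_ones n \<noteq> 0)"
    unfolding eigenvector_def by (auto simp: A all_ones_def scalar_prod_def)
  also have "\<dots> \<longleftrightarrow> (\<exists>f. A *\<^sub>v vec_of f = x \<cdot>\<^sub>v vec_of f \<and> vec_of f \<bullet> all_ones n \<noteq> 0)"
    using surj by (auto simp: vec_of_def intro!: bexI[of _ "vec_of _"])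
  finally show ?thesis
    by (simp add: mult eq ones)
qed

text \<open>
  This is \<open>P(A) f\<close>, evaluated like \<^const>\<open>poly\<close> by Horner's scheme so that the facts about it follow by
  induction on the polynomial.
\<close>
definition poly_nbr_sum :: "'a pair_pre_digraph \<Rightarrow> real poly \<Rightarrow> ('a \<Rightarrow> real) \<Rightarrow> 'a \<Rightarrow> real" where
  "poly_nbr_sum G P = fold_coeffs (\<lambda>c H f v. c * f v + H (nbr_sum G f) v) P (\<lambda>f v. 0)"

lemma poly_nbr_sum_0 [simp]: "poly_nbr_sum G 0 f v = 0"
  by (simp add: poly_nbr_sum_def)

lemma poly_nbr_sum_pCons [simp]:
  "poly_nbr_sum G (pCons c P) f v = c * f v + poly_nbr_sum G P (nbr_sum G f) v"
  by (cases "P = 0 \<and> c = 0") (auto simp: poly_nbr_sum_def)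

lemma poly_nbr_sum_add:
  "poly_nbr_sum G (P + Q) f v = poly_nbr_sum G P f v + poly_nbr_sum G Q f v"
  by (induction P Q arbitrary: f rule: poly_induct2) (simp_all add: algebra_simps)

lemma poly_nbr_sum_smult:
  "poly_nbr_sum G (Polynomial.smult c P) f v = c * poly_nbr_sum G P f v"
  by (induction P arbitrary: f) (simp_all add: algebra_simps)

lemma nbr_sum_poly_nbr_sum:
  "nbr_sum G (poly_nbr_sum G P f) v = poly_nbr_sum G P (nbr_sum G f) v"
proof (induction P arbitrary: f)
  case 0
  have "poly_nbr_sum G 0 f = (\<lambda>v. 0)" for f by (rule ext) simp
  then show ?case by (simp add: nbr_sum_def)
next
  case (pCons c P)
  have "poly_nbr_sum G (pCons c P) f = (\<lambda>v. c * f v + poly_nbr_sum G P (nbr_sum G f) v)"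
    by (rule ext) simp
  then show ?case
    by (simp add: nbr_sum_add nbr_sum_scale pCons.IH)
qed

text \<open>
  As \<open>A\<close> is symmetric, \<open>P(A)\<close> can be moved to the eigenfunction \<open>g\<close>, on which it acts as the scalar
  \<open>P(x)\<close>.
\<close>
lemma inner_poly_nbr_sum_eigenfunction:
  assumes fin: "finite (pverts G)" and sym: "sym (parcs G)"
    and eig: "\<forall>v\<in>pverts G. nbr_sum G g v = x * g v"
  shows "(\<Sum>v\<in>pverts G. poly_nbr_sum G P f v * g v) = poly P x * (\<Sum>v\<in>pverts G. f v * g v)"
proof (induction P arbitrary: f)
  case 0
  then show ?case by simp
next
  case (pCons c P)
  have "(\<Sum>v\<in>pverts G. nbr_sum G f v * g v) = x * (\<Sum>v\<in>pverts G. f v * g v)"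
    unfolding nbr_sum_self_adjoint[OF fin sym] sum_distrib_left
    by (intro sum.cong) (simp_all add: eig)
  then show ?case
    by (simp add: distrib_right sum.distrib pCons.IH mult.assoc flip: sum_distrib_left)
qed

text \<open>
  If \<open>g\<close> is an eigenfunction for \<open>x\<close>, then \<open>0 = \<langle>P(A) j, g\<rangle> = P(x) \<langle>j, g\<rangle>\<close>, so \<open>P(x) = 0\<close> if \<open>x\<close> is
  main. Conversely, if \<open>P = (X - x) Q\<close>, then \<open>f = Q(A) j\<close> is an eigenfunction for \<open>x\<close>, nonzero by
  minimality, and \<open>0 < \<langle>f, f\<rangle> = Q(x) \<langle>j, f\<rangle>\<close> shows that it is not orthogonal to \<open>j\<close>.
\<close>
theorem main_eigenvalues_eq_roots:
  assumes fin: "finite (pverts G)" and sym: "sym (parcs G)" and "P \<noteq> 0"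
    and annih: "\<forall>v\<in>pverts G. poly_nbr_sum G P (\<lambda>_. 1) v = 0"
    and minimal: "\<And>Q. Q \<noteq> 0 \<Longrightarrow> degree Q < degree P \<Longrightarrow>
      \<exists>v\<in>pverts G. poly_nbr_sum G Q (\<lambda>_. 1) v \<noteq> 0"
  shows "main_eigenvalues G = {x. poly P x = 0}"
proof (intro equalityI subsetI)
  fix x assume "x \<in> main_eigenvalues G"
  then obtain f where f: "\<forall>v\<in>pverts G. nbr_sum G f v = x * f v" "(\<Sum>v\<in>pverts G. f v) \<noteq> 0"
    by (auto simp: main_eigenvalues_def main_eigenvalue_iff_nbr_sum[OF fin])
  have "poly P x * (\<Sum>v\<in>pverts G. f v) = (\<Sum>v\<in>pverts G. poly_nbr_sum G P (\<lambda>_. 1) v * f v)"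
    by (simp add: inner_poly_nbr_sum_eigenfunction[OF fin sym f(1)])
  also have "\<dots> = 0" using annih by simp
  finally show "x \<in> {x. poly P x = 0}" using f(2) by simp
next
  fix x assume "x \<in> {x. poly P x = 0}"
  then obtain Q where Q: "P = [:-x, 1:] * Q"
    by (auto simp: poly_eq_0_iff_dvd elim: dvdE)
  with \<open>P \<noteq> 0\<close> have "Q \<noteq> 0" by auto
  then have "degree Q < degree P"
    unfolding Q by (subst degree_mult_eq) simp_all
  define f where "f = poly_nbr_sum G Q (\<lambda>_. 1)"
  have eig: "\<forall>v\<in>pverts G. nbr_sum G f v = x * f v"
  proof
    fix v assume "v \<in> pverts G"
    have "P = Polynomial.smult (-x) Q + pCons 0 Q" using Q by simp
    then have "poly_nbr_sum G P (\<lambda>_. 1) v = - x * f v + nbr_sum G f v"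
      by (simp add: poly_nbr_sum_add poly_nbr_sum_smult f_def nbr_sum_poly_nbr_sum
               del: Polynomial.smult_minus_left)
    then show "nbr_sum G f v = x * f v" using annih \<open>v \<in> pverts G\<close> by auto
  qed
  obtain v where "v \<in> pverts G" "f v \<noteq> 0"
    using minimal[OF \<open>Q \<noteq> 0\<close> \<open>degree Q < degree P\<close>] by (auto simp: f_def)
  then have "0 < (\<Sum>v\<in>pverts G. f v * f v)"
    using fin by (intro sum_pos2[of _ v]) (auto simp: zero_less_mult_iff)
  also have "\<dots> = poly Q x * (\<Sum>v\<in>pverts G. f v)"
    using inner_poly_nbr_sum_eigenfunction[OF fin sym eig, of Q "\<lambda>_. 1"] by (simp add: f_def)
  finally have "(\<Sum>v\<in>pverts G. f v) \<noteq> 0" by auto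
  with eig show "x \<in> main_eigenvalues G"
    by (auto simp: main_eigenvalues_def main_eigenvalue_iff_nbr_sum[OF fin])
qed

section \<open>Trees given by a parent function\<close>

text \<open>
  The depth makes every chain of parents end at the root, and gives the cycles of the graph a
  vertex with no child on the cycle.
\<close>
locale rooted_tree = pair_graph +
  fixes root :: 'a and parent :: "'a \<Rightarrow> 'a" and depth :: "'a \<Rightarrow> nat"
  assumes root_in_verts: "root \<in> pverts G"
    and depth_root: "depth root = 0"
    and parent_arc: "\<And>v. v \<in> pverts G \<Longrightarrow> v \<noteq> root \<Longrightarrow>
      (v, parent v) \<in> parcs G \<and> depth v = Suc (depth (parent v))"
    and arc_cases: "\<And>u v. (u, v) \<in> parcs G \<Longrightarrow>
      u = parent v \<and> depth v = Suc (depth u) \<or> v = parent u \<and> depth u = Suc (depth v)"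
begin

lemma awalk_to_root:
  "v \<in> pverts G \<Longrightarrow> \<exists>p. awalk v p root \<and> length p = depth v"
proof (induction "depth v" arbitrary: v)
  case 0
  then have "v = root" using parent_arc[of v] by fastforce
  then have "awalk v [] root" using 0 by (simp add: awalk_Nil_iff)
  then show ?case using 0 by (intro exI[of _ "[]"]) simp
next
  case (Suc n)
  then have "v \<noteq> root" using depth_root by auto
  with Suc.prems have par: "(v, parent v) \<in> parcs G" "depth v = Suc (depth (parent v))"
    using parent_arc by auto
  then obtain p where "awalk (parent v) p root" "length p = n"
    using Suc.hyps in_arcsD2 by (metis nat.inject)
  with par Suc.hyps(2) show ?case
    by (intro exI[of _ "(v, parent v) # p"]) (simp add: awalk_Cons_iff)
qed

lemma awalk_via_root:
  assumes "u \<in> pverts G" "v \<in> pverts G"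
  shows "\<exists>p. awalk u p v \<and> length p = depth u + depth v"
proof -
  obtain p q where "awalk u p root" "length p = depth u" "awalk v q root" "length q = depth v"
    using assms awalk_to_root by meson
  moreover have "length (rev_path q) = length q" for q :: "('a \<times> 'a) list"
    by (induction q) auto
  ultimately show ?thesis
    by (intro exI[of _ "p @ rev_path q"]) (auto intro: awalk_appendI awalk_rev_path')
qed

lemma awalk_cost_1: "awalk_cost (\<lambda>_. 1) p = real (length p)"
  by (induction p) auto

lemma graph_dist_le:
  assumes "u \<in> pverts G" "v \<in> pverts G"
  shows "graph_dist G u v \<le> ereal (real (depth u + depth v))"
  using awalk_via_root[OF assms] min_cost_le_walk_cost[of u _ v "\<lambda>_. 1"]
  unfolding graph_dist_def awalk_cost_1 by metis

lemma connected: "Digraph_Component.connected (with_proj G)"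
proof -
  have "(u, v) \<in> rtrancl_on (pverts G) (parcs G)" if "u \<in> pverts G" "v \<in> pverts G" for u v
    using awalk_via_root[OF that] reachable_awalkI unfolding reachable_def with_proj_simps by blast
  then have "(u, v) \<in> rtrancl_on (pverts G) ((parcs G)\<^sup>s)" if "u \<in> pverts G" "v \<in> pverts G" for u v
    using that rtrancl_on_mono[of "parcs G" "(parcs G)\<^sup>s" "pverts G" "pverts G" u v]
    by (auto simp: symcl_def)
  then show ?thesis
    using root_in_verts by (auto simp: connected_conv)
qed

lemma awalk_nth_arc:
  "awalk u p v \<Longrightarrow> i < length p \<Longrightarrow> (awalk_verts u p ! i, awalk_verts u p ! Suc i) \<in> parcs G"
proof (induction p arbitrary: u i)
  case (Cons e p)
  have e: "(u, snd e) \<in> parcs G" "awalk (snd e) p v" "fst e = u"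
    using Cons.prems(1) by (auto simp: awalk_Cons_iff)
  have "awalk_verts (snd e) p ! 0 = snd e"
    using awhd_of_awalk[OF e(2)] by (metis awalk_verts_non_Nil hd_conv_nth)
  then show ?case
    using e Cons.IH[OF e(2)] Cons.prems(2) by (cases i) auto
qed simp

text \<open>
  A vertex of maximal depth on a cycle has both its neighbours on the cycle at smaller depth, so both
  are its parent. They coincide, which leaves only the back-and-forth walk along one edge.
\<close>
lemma cycle_length_le_2:
  assumes "cycle p"
  shows "length p \<le> 2"
proof (rule ccontr)
  assume long: "\<not> length p \<le> 2"
  obtain u where walk: "awalk u p u" and dist: "distinct (tl (awalk_verts u p))"
    using assms by (auto simp: cycle_def)
  define n where "n = length p"
  define vs where "vs = awalk_verts u p"
  have n: "3 \<le> n" using long by (simp add: n_def)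
  have len: "length vs = Suc n" by (simp add: vs_def n_def length_awalk_verts)
  have closed: "vs ! 0 = vs ! n"
    using awhd_of_awalk[OF walk] awends_of_awalk(2)[OF walk] len
    by (metis awalkE' hd_conv_nth last_conv_nth diff_Suc_1 length_0_conv nat.distinct(1) vs_def walk)
  have arc: "(vs ! i, vs ! Suc i) \<in> parcs G" if "i < n" for i
    using awalk_nth_arc[OF walk] that by (simp add: vs_def n_def)
  have inj: "i = j" if "vs ! i = vs ! j" "1 \<le> i" "i \<le> n" "1 \<le> j" "j \<le> n" for i j
    using that dist len unfolding vs_def[symmetric]
    by (cases vs; cases i; cases j) (auto simp: nth_eq_iff_index_eq)
  obtain i where i: "1 \<le> i" "i \<le> n" and max: "\<And>j. 1 \<le> j \<Longrightarrow> j \<le> n \<Longrightarrow> depth (vs ! j) \<le> depth (vs ! i)"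
  proof -
    let ?D = "(\<lambda>i. depth (vs ! i)) ` {1..n}"
    have ge: "depth (vs ! j) \<le> Max ?D" if "1 \<le> j" "j \<le> n" for j
      using that by (intro Max_ge) auto
    have "Max ?D \<in> ?D" using n by (intro Max_in) auto
    then obtain i where i: "Max ?D = depth (vs ! i)" "i \<in> {1..n}"
      by (rule imageE)
    show ?thesis
      by (rule that[of i]) (use i(2) ge[unfolded i(1)] in auto)
  qed
  have nbr: "vs ! j = parent (vs ! i)"
    if "(vs ! i, vs ! j) \<in> parcs G" "j \<le> n" for j
  proof -
    have "depth (vs ! j) \<le> depth (vs ! i)"
      using max[of j] max[of n] that n closed by (cases "j = 0") auto
    then show ?thesis using arc_cases[OF that(1)] by auto
  qed
  \<comment> \<open>The positions are taken from \<open>1\<close> to \<open>n\<close>, where the vertices are distinct, so position \<open>0\<close> is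
    replaced by \<open>n\<close> and the successor of \<open>n\<close> by \<open>1\<close>.\<close>
  define k where "k = (if i = n then 1 else Suc i)"
  have "(vs ! i, vs ! k) \<in> parcs G"
    using arc[of i] arc[of 0] closed i n by (auto simp: k_def)
  moreover have "(vs ! i, vs ! (i - 1)) \<in> parcs G"
    using arc[of "i - 1"] i by (auto intro: arcs_symmetric)
  ultimately have "vs ! k = vs ! (i - 1)"
    using nbr[of k] nbr[of "i - 1"] i n by (auto simp: k_def)
  then have "vs ! k = vs ! (if i = 1 then n else i - 1)"
    using closed by auto
  then have "k = (if i = 1 then n else i - 1)"
    by (rule inj) (use i n in \<open>auto simp: k_def\<close>)
  then show False using i n by (auto simp: k_def split: if_splits)
qed

lemma undirected_tree: "undirected_tree G"
  unfolding undirected_tree_def using pair_graph connected cycle_length_le_2 by fastforce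

end

lemma (in pair_graph) graph_dist_ge:
  fixes f :: "'a \<Rightarrow> int"
  assumes "\<And>x y. (x, y) \<in> parcs G \<Longrightarrow> f y - f x \<le> 1"
  shows "ereal (of_int (f v - f u)) \<le> graph_dist G u v"
  unfolding graph_dist_def \<mu>_def
proof (rule INF_greatest)
  fix p assume "p \<in> {p. awalk u p v}"
  then have "awalk u p v" by simp
  then have "real_of_int (f v - f u) \<le> awalk_cost (\<lambda>_. 1) p"
  proof (induction p arbitrary: u)
    case Nil
    then show ?case by (simp add: awalk_Nil_iff)
  next
    case (Cons e p)
    have e: "(u, snd e) \<in> parcs G" "awalk (snd e) p v"
      using Cons.prems by (auto simp: awalk_Cons_iff)
    show ?case
      using Cons.IH[OF e(2)] assms[OF e(1)] by simp
  qed
  then show "ereal (of_int (f v - f u)) \<le> ereal (awalk_cost (\<lambda>_. 1) p)" by simp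
qed

section \<open>Level-uniform trees with pendant vertices\<close>

lemma Nil_in_B_verts [simp]: "[] \<in> B_verts ds"
  by (simp add: B_verts_def)

lemma snoc_in_B_verts_iff:
  "p @ [c] \<in> B_verts ds \<longleftrightarrow>
    p \<in> B_verts ds \<and> length p < length ds \<and> c < num_children ds (length p)"
  by (auto simp: B_verts_def nth_append less_Suc_eq)

lemma singleton_in_B_verts_iff: "[c] \<in> B_verts ds \<longleftrightarrow> ds \<noteq> [] \<and> c < num_children ds 0"
  using snoc_in_B_verts_iff[of "[]" c ds] by simp

lemma butlast_in_B_verts: "p \<in> B_verts ds \<Longrightarrow> butlast p \<in> B_verts ds"
  by (auto simp: B_verts_def nth_butlast)

lemma finite_B_verts: "finite (B_verts ds)"
proof (rule finite_subset)
  let ?C = "\<Union>k<length ds. {..<num_children ds k}"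
  show "B_verts ds \<subseteq> {p. set p \<subseteq> ?C \<and> length p \<le> length ds}"
    by (force simp: B_verts_def in_set_conv_nth)
  show "finite {p. set p \<subseteq> ?C \<and> length p \<le> length ds}"
    by (rule finite_lists_length_le) simp
qed

lemma pverts_attach_B_tree:
  "pverts (attach_pendants (B_tree ds) s) =
    Inl ` B_verts ds \<union> Inr ` (SIGMA p:B_verts ds. {..<s p})"
  by (auto simp: attach_pendants_def B_tree_def)

lemma Inl_arc_iff:
  "(Inl p, w) \<in> parcs (attach_pendants (B_tree ds) s) \<longleftrightarrow>
    w \<in> pverts (attach_pendants (B_tree ds) s) \<and> p \<in> B_verts ds \<and>
    ((\<exists>c. w = Inl (p @ [c])) \<or> (\<exists>k. w = Inr (p, k)) \<or> p \<noteq> [] \<and> w = Inl (butlast p))"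
  by (cases p rule: rev_cases) (auto simp: attach_pendants_def B_tree_def)

lemma Inr_arc_iff:
  "(Inr (p, k), w) \<in> parcs (attach_pendants (B_tree ds) s) \<longleftrightarrow>
    w = Inl p \<and> p \<in> B_verts ds \<and> k < s p"
  by (auto simp: attach_pendants_def)
    (auto simp: B_tree_def)

lemma rooted_tree_attach_B_tree:
  "rooted_tree (attach_pendants (B_tree ds) s) (Inl [])
    (case_sum (\<lambda>p. Inl (butlast p)) (\<lambda>(p, k). Inl p))
    (case_sum length (\<lambda>(p, k). Suc (length p)))"
  (is "rooted_tree ?G _ ?par ?dep")
proof -
  have fin: "finite (pverts ?G)"
    by (auto simp: pverts_attach_B_tree finite_B_verts)
  have wf: "u \<in> pverts ?G \<and> v \<in> pverts ?G" if "(u, v) \<in> parcs ?G" for u v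
    using that by (auto simp: attach_pendants_def B_tree_def)
  have sym: "sym (parcs ?G)"
    by (auto simp: sym_def attach_pendants_def B_tree_def)
  have cases: "u = ?par v \<and> ?dep v = Suc (?dep u) \<or> v = ?par u \<and> ?dep u = Suc (?dep v)"
    if "(u, v) \<in> parcs ?G" for u v
    using that by (auto simp: attach_pendants_def B_tree_def)
  show ?thesis
  proof unfold_locales
    show "finite (parcs ?G)"
      by (rule finite_subset[of _ "pverts ?G \<times> pverts ?G"]) (use wf fin in auto)
    show "symmetric ?G" using sym by (simp add: symmetric_def)
    show "fst e \<noteq> snd e" if "e \<in> parcs ?G" for e
      using cases[of "fst e" "snd e"] that by auto
    fix v assume "v \<in> pverts ?G" "v \<noteq> Inl []"
    then show "(v, ?par v) \<in> parcs ?G \<and> ?dep v = Suc (?dep (?par v))"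
      by (cases v) (auto simp: Inl_arc_iff Inr_arc_iff pverts_attach_B_tree butlast_in_B_verts)
  next
    show "fst e \<in> pverts ?G" "snd e \<in> pverts ?G" if "e \<in> parcs ?G" for e
      using wf[of "fst e" "snd e"] that by auto
    show "Inl [] \<in> pverts ?G" by (simp add: pverts_attach_B_tree)
  qed (fact fin | fact cases | simp)+
qed

section \<open>Functions that are constant on levels\<close>

lemma nbr_sum_Inr:
  assumes "p \<in> B_verts ds" "k < s p"
  shows "nbr_sum (attach_pendants (B_tree ds) s) f (Inr (p, k)) = f (Inl p)"
proof -
  have "{w \<in> pverts (attach_pendants (B_tree ds) s). (Inr (p, k), w) \<in> parcs (attach_pendants (B_tree ds) s)} = {Inl p}"
    using assms by (auto simp: Inr_arc_iff pverts_attach_B_tree)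
  then show ?thesis by (simp add: nbr_sum_def)
qed

lemma nbr_sum_Inl:
  assumes p: "p \<in> B_verts ds"
  shows "nbr_sum (attach_pendants (B_tree ds) s) f (Inl p) =
    (if p = [] then 0 else f (Inl (butlast p)))
    + (\<Sum>c<(if length p < length ds then num_children ds (length p) else 0). f (Inl (p @ [c])))
    + (\<Sum>k<s p. f (Inr (p, k)))"
proof -
  let ?G = "attach_pendants (B_tree ds) s"
  define U :: "(nat list + nat list \<times> nat) set" where "U = (if p = [] then {} else {Inl (butlast p)})"
  define D :: "(nat list + nat list \<times> nat) set" where "D = (\<lambda>c. Inl (p @ [c])) ` {..<if length p < length ds then num_children ds (length p) else 0}"
  define P :: "(nat list + nat list \<times> nat) set" where "P = (\<lambda>k. Inr (p, k)) ` {..<s p}"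
  have nbrs: "{w \<in> pverts ?G. (Inl p, w) \<in> parcs ?G} = U \<union> D \<union> P"
    unfolding U_def D_def P_def
    using p by (auto simp: Inl_arc_iff pverts_attach_B_tree snoc_in_B_verts_iff
        singleton_in_B_verts_iff butlast_in_B_verts)
  have ne: "butlast p \<noteq> p @ [c]" for c
  proof
    assume "butlast p = p @ [c]"
    from arg_cong[OF this, of length] show False by simp
  qed
  have "U \<inter> D = {}" "(U \<union> D) \<inter> P = {}"
    by (auto simp: ne U_def D_def P_def)
  moreover have "finite U" "finite D" "finite P" by (auto simp: U_def D_def P_def)
  ultimately have "sum f (U \<union> D \<union> P) = sum f U + sum f D + sum f P"
    by (simp only: sum.union_disjoint finite_UnI)
  also have "sum f D = (\<Sum>c<(if length p < length ds then num_children ds (length p) else 0). f (Inl (p @ [c])))"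
    unfolding D_def by (subst sum.reindex) (auto simp: inj_on_def)
  also have "sum f P = (\<Sum>k<s p. f (Inr (p, k)))"
    unfolding P_def by (subst sum.reindex) (auto simp: inj_on_def)
  finally show ?thesis
    unfolding nbr_sum_def nbrs by (simp add: U_def)
qed

definition level_fun :: "(nat \<Rightarrow> real) \<Rightarrow> (nat \<Rightarrow> real) \<Rightarrow> nat list + nat list \<times> nat \<Rightarrow> real" where
  "level_fun a b = case_sum (\<lambda>p. a (length p)) (\<lambda>(p, k). b (length p))"

text \<open>
  The step of the recurrence: a vertex at depth \<open>k\<close> has a parent unless \<open>k = 0\<close>, and children and
  pendant vertices unless it is a leaf of the last level. On pendant vertices the operator just
  copies the value \<open>a\<close> of their neighbour.
\<close>
lemma nbr_sum_level_fun:
  assumes inner: "\<And>k. k \<le> length ds \<Longrightarrow>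
      a' k = (if k = 0 then 0 else a (k - 1))
        + (if k < length ds then real (num_children ds k) * a (Suc k) else 0)
        + (if k < length ts then real (ts ! k) * b k else 0)"
    and v: "v \<in> pverts (B_ext ds ts)"
  shows "nbr_sum (B_ext ds ts) (level_fun a b) v = level_fun a' a v"
proof (cases v)
  case (Inl p)
  with v have p: "p \<in> B_verts ds" by (auto simp: B_ext_def pverts_attach_B_tree)
  then have "length p \<le> length ds" by (simp add: B_verts_def)
  from inner[OF this] show ?thesis
    unfolding Inl B_ext_def nbr_sum_Inl[OF p] by (simp add: level_fun_def)
next
  case (Inr q)
  with v show ?thesis
    by (cases q) (auto simp: B_ext_def pverts_attach_B_tree nbr_sum_Inr level_fun_def)
qed

section \<open>The diameter of a level-uniform tree with pendant vertices\<close>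

lemma replicate_in_B_verts:
  assumes "\<And>k. k < length ds \<Longrightarrow> 0 < num_children ds k" "k \<le> length ds"
  shows "replicate k 0 \<in> B_verts ds"
  using assms by (simp add: B_verts_def)

text \<open>
  A pendant vertex hangs from a vertex above the last level, so it is no deeper than that level. This
  gives the upper bound through the root. Two children of the root are needed for the lower bound,
  which the leaves \<open>u\<close> and \<open>v\<close> below the children \<open>0\<close> and \<open>1\<close> attain.
\<close>
theorem diam_B_ext:
  assumes ne: "ds \<noteq> []" and len: "length ts = length ds"
    and children: "\<And>k. k < length ds \<Longrightarrow> 0 < num_children ds k" and root: "2 \<le> num_children ds 0"
  shows "diam (B_ext ds ts) = ereal (real (2 * length ds))"
proof (rule antisym)
  interpret rooted_tree "B_ext ds ts" "Inl []" "case_sum (\<lambda>p. Inl (butlast p)) (\<lambda>(p, k). Inl p)"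
    "case_sum length (\<lambda>(p, k). Suc (length p))"
    unfolding B_ext_def by (rule rooted_tree_attach_B_tree)
  have depth: "case_sum length (\<lambda>(p, k). Suc (length p)) v \<le> length ds"
    if "v \<in> pverts (B_ext ds ts)" for v
    using that len by (auto simp: B_ext_def pverts_attach_B_tree B_verts_def split: if_splits)
  show "diam (B_ext ds ts) \<le> ereal (real (2 * length ds))"
    unfolding diam_def
  proof (clarsimp intro!: SUP_least)
    fix u v assume uv: "u \<in> pverts (B_ext ds ts)" "v \<in> pverts (B_ext ds ts)"
    show "graph_dist (B_ext ds ts) u v \<le> ereal (2 * real (length ds))"
      by (rule order_trans[OF graph_dist_le[OF uv]]) (use depth[OF uv(1)] depth[OF uv(2)] in simp)
  qed
  let ?u = "Inl (replicate (length ds) 0) :: nat list + nat list \<times> nat"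
  let ?v = "Inl (1 # replicate (length ds - 1) 0) :: nat list + nat list \<times> nat"
  \<comment> \<open>The signed depth, negative below the child \<open>0\<close> of the root. A pendant vertex may copy the value
    of its neighbour, as only an upper bound on the change along an arc matters.\<close>
  define f where "f = (\<lambda>p :: nat list. if p \<noteq> [] \<and> hd p = 0 then - int (length p) else int (length p))"
  define g :: "nat list + nat list \<times> nat \<Rightarrow> int" where "g = case_sum f (\<lambda>(p, k). f p)"
  have "f (p @ [c]) - f p \<le> 1 \<and> f p - f (p @ [c]) \<le> 1" for p c
    by (auto simp: f_def hd_append)
  then have lip: "g y - g x \<le> 1" if "(x, y) \<in> parcs (B_ext ds ts)" for x y
    using that by (auto simp: g_def B_ext_def attach_pendants_def B_tree_def)
  have "int (2 * length ds) = g ?v - g ?u"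
    using ne by (auto simp: g_def f_def)
  then have "real (2 * length ds) = of_int (g ?v - g ?u)"
    by (metis of_int_of_nat_eq)
  then have "ereal (real (2 * length ds)) \<le> graph_dist (B_ext ds ts) ?u ?v"
    using graph_dist_ge[of g, OF lip, of ?v ?u] by simp
  moreover have "?u \<in> pverts (B_ext ds ts)"
    using replicate_in_B_verts[OF children] by (simp add: B_ext_def pverts_attach_B_tree)
  moreover have "?v \<in> pverts (B_ext ds ts)"
    using children root ne by (auto simp: B_ext_def pverts_attach_B_tree B_verts_def nth_Cons' Suc_le_eq)
  ultimately show "ereal (real (2 * length ds)) \<le> diam (B_ext ds ts)"
    unfolding diam_def by (intro SUP_upper2[of "(?u, ?v)"]) simp_all
qed

section \<open>The trees with three main eigenvalues\<close>

text \<open>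
  With \<open>n = h - 5\<close>, the depths below \<open>n\<close> are the levels \<open>C\<^sub>h, \<dots>, C\<^sub>6\<close>, and depth \<open>n + i\<close> is
  \<open>C\<^bsub>5-i\<^esub>\<close>.
\<close>
definition T_ds :: "nat \<Rightarrow> nat list" where
  "T_ds n = replicate n 7 @ [11, 3, 163, 13]"

definition T_ts :: "nat \<Rightarrow> nat list" where
  "T_ts n = replicate n 84 @ [80, 52, 0, 0]"

lemma length_T [simp]: "length (T_ds n) = n + 4" "length (T_ts n) = n + 4"
  by (simp_all add: T_ds_def T_ts_def)

lemma depth_cases:
  fixes k n :: nat
  assumes "k \<le> n + 4"
  obtains "k < n" | "k = n" | "k = n + 1" | "k = n + 2" | "k = n + 3" | "k = n + 4"
  using assms by linarith

text \<open>
  The numbers of walks of length \<open>1\<close> and \<open>2\<close> that start at a vertex of the given depth in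
  the level-uniform tree. On an attached pendant vertex they are \<open>1\<close> and the degree of its neighbour.
\<close>
definition T_walks1 :: "nat \<Rightarrow> nat \<Rightarrow> real" where
  "T_walks1 n k = (if k \<le> n then 91 else if k = n + 1 then 55 else if k = n + 2 then 163
    else if k = n + 3 then 13 else 1)"

definition T_walks2 :: "nat \<Rightarrow> nat \<Rightarrow> real" where
  "T_walks2 n k = (if k \<le> n then 721 else if k = n + 1 then 469 else if k = n + 2 then 2161
    else if k = n + 3 then 175 else 13)"

lemma num_children_T:
  assumes "0 < n" "k < n + 4"
  shows "num_children (T_ds n) k = (if k = 0 then 7 else if k < n then 6 else if k = n then 10
    else if k = n + 1 then 2 else if k = n + 2 then 162 else 12)"
proof -
  have "k \<le> n + 4" using assms by simp
  then show ?thesis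
    by (cases rule: depth_cases) (use assms in \<open>auto simp: num_children_def T_ds_def nth_append\<close>)
qed

lemma nth_T_ts:
  assumes "k < n + 4"
  shows "T_ts n ! k = (if k < n then 84 else if k = n then 80 else if k = n + 1 then 52 else 0)"
proof -
  have "k \<le> n + 4" using assms by simp
  then show ?thesis
    by (cases rule: depth_cases) (use assms in \<open>auto simp: T_ts_def nth_append\<close>)
qed

text \<open>
  The three applications of \<open>A\<close> to \<open>j\<close>. On the pendant vertices the last equation is
  \<open>a\<^sub>2 = 7 a\<^sub>1 + 84\<close> for the values \<open>a\<^sub>1, a\<^sub>2\<close> at the neighbour. It fails at \<open>C\<^sub>1\<close> and \<open>C\<^sub>3\<close> and holds
  from \<open>C\<^sub>4\<close> upwards, which are the levels with pendant vertices.
\<close>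
lemma
  assumes n: "0 < n" and v: "v \<in> pverts (B_ext (T_ds n) (T_ts n))"
  shows nbr_sum_T_1: "nbr_sum (B_ext (T_ds n) (T_ts n)) (\<lambda>_. 1) v = level_fun (T_walks1 n) (\<lambda>_. 1) v"
    and nbr_sum_T_walks1: "nbr_sum (B_ext (T_ds n) (T_ts n)) (level_fun (T_walks1 n) (\<lambda>_. 1)) v
      = level_fun (T_walks2 n) (T_walks1 n) v"
    and nbr_sum_T_walks2: "nbr_sum (B_ext (T_ds n) (T_ts n)) (level_fun (T_walks2 n) (T_walks1 n)) v
      = 7 * level_fun (T_walks2 n) (T_walks1 n) v + 84 * level_fun (T_walks1 n) (\<lambda>_. 1) v"
proof -
  let ?G = "B_ext (T_ds n) (T_ts n)"
  have one: "(\<lambda>_. 1) = level_fun (\<lambda>_. 1) (\<lambda>_. 1)"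
    by (auto simp: level_fun_def fun_eq_iff split: sum.splits)
  show "nbr_sum ?G (\<lambda>_. 1) v = level_fun (T_walks1 n) (\<lambda>_. 1) v"
    unfolding one
  proof (rule nbr_sum_level_fun[OF _ v])
    fix k assume "k \<le> length (T_ds n)"
    then have "k \<le> n + 4" by simp
    then show "T_walks1 n k = (if k = 0 then 0 else 1)
        + (if k < length (T_ds n) then real (num_children (T_ds n) k) * 1 else 0)
        + (if k < length (T_ts n) then real (T_ts n ! k) * 1 else 0)"
      by (cases rule: depth_cases) (use n in \<open>auto simp: nth_T_ts num_children_T T_walks1_def\<close>)
  qed
  show "nbr_sum ?G (level_fun (T_walks1 n) (\<lambda>_. 1)) v = level_fun (T_walks2 n) (T_walks1 n) v"
  proof (rule nbr_sum_level_fun[OF _ v])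
    fix k assume "k \<le> length (T_ds n)"
    then have "k \<le> n + 4" by simp
    then show "T_walks2 n k = (if k = 0 then 0 else T_walks1 n (k - 1))
        + (if k < length (T_ds n) then real (num_children (T_ds n) k) * T_walks1 n (Suc k) else 0)
        + (if k < length (T_ts n) then real (T_ts n ! k) * 1 else 0)"
      by (cases rule: depth_cases)
        (use n in \<open>auto simp: nth_T_ts num_children_T T_walks1_def T_walks2_def\<close>)
  qed
  have "nbr_sum ?G (level_fun (T_walks2 n) (T_walks1 n)) v
      = level_fun (\<lambda>k. 7 * T_walks2 n k + 84 * T_walks1 n k) (T_walks2 n) v"
  proof (rule nbr_sum_level_fun[OF _ v])
    fix k assume "k \<le> length (T_ds n)"
    then have "k \<le> n + 4" by simp
    then show "7 * T_walks2 n k + 84 * T_walks1 n k = (if k = 0 then 0 else T_walks2 n (k - 1))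
        + (if k < length (T_ds n) then real (num_children (T_ds n) k) * T_walks2 n (Suc k) else 0)
        + (if k < length (T_ts n) then real (T_ts n ! k) * T_walks1 n k else 0)"
      by (cases rule: depth_cases)
        (use n in \<open>auto simp: nth_T_ts num_children_T T_walks1_def T_walks2_def\<close>)
  qed
  also have "\<dots> = 7 * level_fun (T_walks2 n) (T_walks1 n) v + 84 * level_fun (T_walks1 n) (\<lambda>_. 1) v"
  proof (cases v)
    case (Inr q)
    obtain p k where q: "q = (p, k)" by force
    have "k < T_ts n ! length p" "length p < n + 4"
      using v unfolding Inr q by (auto simp: B_ext_def pverts_attach_B_tree split: if_splits)
    then have "length p \<le> n + 1"
      by (auto simp: nth_T_ts split: if_splits)
    then show ?thesis
      unfolding Inr q by (auto simp: level_fun_def T_walks1_def T_walks2_def)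
  qed (simp add: level_fun_def)
  finally show "nbr_sum ?G (level_fun (T_walks2 n) (T_walks1 n)) v
      = 7 * level_fun (T_walks2 n) (T_walks1 n) v + 84 * level_fun (T_walks1 n) (\<lambda>_. 1) v" .
qed

text \<open>
  A polynomial \<open>a + b x + c x\<^sup>2\<close> that annihilates \<open>j\<close> vanishes, by its values on a vertex of \<open>C\<^sub>1\<close>, a
  vertex of \<open>C\<^sub>2\<close> and a pendant vertex at the root, where \<open>(j, A j, A\<^sup>2 j)\<close> is \<open>(1, 1, 13)\<close>,
  \<open>(1, 13, 175)\<close> and \<open>(1, 1, 91)\<close>.
\<close>
lemma main_eigenvalues_T:
  assumes n: "0 < n"
  shows "main_eigenvalues (B_ext (T_ds n) (T_ts n)) = {x. poly [:0, -84, -7, 1:] x = 0}"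
proof -
  define G where "G = B_ext (T_ds n) (T_ts n)"
  interpret rooted_tree G "Inl []" "case_sum (\<lambda>p. Inl (butlast p)) (\<lambda>(p, k). Inl p)"
    "case_sum length (\<lambda>(p, k). Suc (length p))"
    unfolding G_def B_ext_def by (rule rooted_tree_attach_B_tree)
  have L1: "nbr_sum G (\<lambda>_. 1) v = level_fun (T_walks1 n) (\<lambda>_. 1) v" if "v \<in> pverts G" for v
    using nbr_sum_T_1[OF n] that by (simp add: G_def)
  have L2: "nbr_sum G (nbr_sum G (\<lambda>_. 1)) v = level_fun (T_walks2 n) (T_walks1 n) v" if "v \<in> pverts G" for v
    using nbr_sum_T_walks1[OF n] that nbr_sum_cong[of G, OF L1] by (simp add: G_def)
  have L3: "nbr_sum G (nbr_sum G (nbr_sum G (\<lambda>_. 1))) v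
      = 7 * level_fun (T_walks2 n) (T_walks1 n) v + 84 * level_fun (T_walks1 n) (\<lambda>_. 1) v"
    if "v \<in> pverts G" for v
    using nbr_sum_T_walks2[OF n] that nbr_sum_cong[of G, OF L2] by (simp add: G_def)
  have "main_eigenvalues G = {x. poly [:0, -84, -7, 1:] x = 0}"
  proof (rule main_eigenvalues_eq_roots)
    show "sym (parcs G)" using pair_sym_arcs by (simp add: symmetric_def)
    show "\<forall>v\<in>pverts G. poly_nbr_sum G [:0, -84, -7, 1:] (\<lambda>_. 1) v = 0"
      by (simp add: L1 L2 L3)
    fix Q :: "real poly" assume Q: "Q \<noteq> 0" "degree Q < degree [:0, -84, -7, 1 :: real:]"
    define a b c where "a = coeff Q 0" and "b = coeff Q 1" and "c = coeff Q 2"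
    have Q_eq: "Q = [:a, b, c:]"
      using Q(2) by (intro poly_eqI)
        (auto simp: a_def b_def c_def coeff_pCons coeff_eq_0 numeral_2_eq_2 split: nat.splits)
    have val: "poly_nbr_sum G Q (\<lambda>_. 1) v
        = a + b * level_fun (T_walks1 n) (\<lambda>_. 1) v + c * level_fun (T_walks2 n) (T_walks1 n) v"
      if "v \<in> pverts G" for v
      using that by (simp add: Q_eq L1 L2)
    have "replicate k 0 \<in> B_verts (T_ds n)" if "k \<le> n + 4" for k
    proof (rule replicate_in_B_verts)
      fix k assume "k < length (T_ds n)"
      then have "k \<le> n + 4" by simp
      then show "0 < num_children (T_ds n) k"
        using \<open>k < length (T_ds n)\<close>
        by (cases rule: depth_cases) (use n in \<open>auto simp: num_children_T\<close>)
    qed (use that in simp)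
    then have verts: "Inl (replicate (n + 4) 0) \<in> pverts G" "Inl (replicate (n + 3) 0) \<in> pverts G"
        "Inr ([], 0) \<in> pverts G"
      using n by (auto simp: G_def B_ext_def pverts_attach_B_tree nth_T_ts)
    show "\<exists>v\<in>pverts G. poly_nbr_sum G Q (\<lambda>_. 1) v \<noteq> 0"
    proof (rule ccontr)
      assume "\<not> ?thesis"
      then have z: "poly_nbr_sum G Q (\<lambda>_. 1) v = 0" if "v \<in> pverts G" for v
        using that by auto
      have "a + b + c * 13 = 0" "a + b * 13 + c * 175 = 0" "a + b + c * 91 = 0"
        using val[OF verts(1)] val[OF verts(2)] val[OF verts(3)] z[OF verts(1)] z[OF verts(2)] z[OF verts(3)]
        by (auto simp: level_fun_def T_walks1_def T_walks2_def)
      then have "a = 0" "b = 0" "c = 0" by linarith+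
      then show False using Q(1) Q_eq by simp
    qed
  qed (use pair_finite_verts in auto)
  then show ?thesis by (simp add: G_def)
qed

lemma main_cubic_roots:
  "{x. poly [:0, -84, -7, 1:] x = 0} = {0, (7 + sqrt 385) / 2, (7 - sqrt 385) / 2}"
proof -
  have "poly [:0, -84, -7, 1:] x = x * (x - (7 + sqrt 385) / 2) * (x - (7 - sqrt 385) / 2)" for x :: real
    by (simp add: field_simps)
  then show ?thesis by (simp only: mult_eq_0_iff) auto
qed

lemma sqrt_385: "7 < sqrt 385"
  by (rule real_less_rsqrt) simp

lemma card_main_cubic_roots: "card {0, (7 + sqrt 385) / 2, (7 - sqrt 385) / 2 :: real} = 3"
  using sqrt_385 by (simp add: card_insert_if)

lemma prod_main_cubic_roots:
  "(\<Prod>x\<in>{0, (7 + sqrt 385) / 2, (7 - sqrt 385) / 2}. [:- x, 1:]) = [:0, -84, -7, 1 :: real:]"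
  using sqrt_385 by (simp add: field_simps)

lemma T_tree_eq: "T_tree h = B_ext (T_ds (h - 5)) (T_ts (h - 5))"
  by (simp add: T_tree_def T_ds_def T_ts_def)

lemma diam_T:
  assumes "0 < n"
  shows "diam (B_ext (T_ds n) (T_ts n)) = ereal (real (2 * (n + 4)))"
proof -
  have pos: "0 < num_children (T_ds n) k" if "k < length (T_ds n)" for k
  proof -
    have "k \<le> n + 4" using that by simp
    then show ?thesis
      using that by (cases rule: depth_cases) (use assms in \<open>auto simp: num_children_T\<close>)
  qed
  have "diam (B_ext (T_ds n) (T_ts n)) = ereal (real (2 * length (T_ds n)))"
    by (rule diam_B_ext) (use assms pos in \<open>auto simp: num_children_T simp flip: length_0_conv\<close>)
  then show ?thesis by simp
qed

theorem mainTheorem4: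
  shows "(\<forall>h\<ge>6.
            card (main_eigenvalues (T_tree h)) = 3 \<and>
            main_char_poly (T_tree h) = [:0, -84, -7, 1:] \<and>
            main_char_poly (T_tree h) = [:0, 1:] * [:-84, -7, 1:] \<and>
            diam (T_tree h) = ereal (real (2 * (h - 1)))) \<and>
         (\<forall>N::nat. \<exists>G :: (nat list + nat list \<times> nat) pair_pre_digraph.
            undirected_tree G \<and> card (main_eigenvalues G) = 3 \<and> ereal (real N) \<le> diam G)"
proof -
  have T: "card (main_eigenvalues (T_tree h)) = 3"
    "main_char_poly (T_tree h) = [:0, -84, -7, 1:]"
    "diam (T_tree h) = ereal (real (2 * (h - 1)))" if "6 \<le> h" for h
  proof -
    have pos: "0 < h - 5" using that by simp
    have main: "main_eigenvalues (T_tree h) = {0, (7 + sqrt 385) / 2, (7 - sqrt 385) / 2}"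
      unfolding T_tree_eq main_eigenvalues_T[OF pos] main_cubic_roots ..
    show "card (main_eigenvalues (T_tree h)) = 3"
      unfolding main by (rule card_main_cubic_roots)
    show "main_char_poly (T_tree h) = [:0, -84, -7, 1:]"
      unfolding main_char_poly_def main by (rule prod_main_cubic_roots)
    have "h - 5 + 4 = h - 1" using that by simp
    then show "diam (T_tree h) = ereal (real (2 * (h - 1)))"
      unfolding T_tree_eq diam_T[OF pos] by simp
  qed
  have factor: "[:0, -84, -7, 1:] = [:0, 1:] * [:-84, -7, 1 :: real:]" by simp
  have "\<exists>G :: (nat list + nat list \<times> nat) pair_pre_digraph.
      undirected_tree G \<and> card (main_eigenvalues G) = 3 \<and> ereal (real N) \<le> diam G" for N :: nat
  proof (intro exI conjI)
    show "undirected_tree (T_tree (N + 6))"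
      unfolding T_tree_def B_ext_def by (rule rooted_tree.undirected_tree[OF rooted_tree_attach_B_tree])
    show "card (main_eigenvalues (T_tree (N + 6))) = 3" by (rule T) simp
    show "ereal (real N) \<le> diam (T_tree (N + 6))" by (subst T(3)) simp_all
  qed
  then show ?thesis
    using T T(2)[unfolded factor] by blast
qed

end
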